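(* For every $A\subset\mathbb{N}$ there exist sets $A'\subset A\subset A''\subset\mathbb{N}$ such that $A'\prec A\prec A''$, where $A'$ is a minimal element and $A''$ is a maximal element of $\mathcal{P}(\mathbb{N})$ with respect to the partial order $\prec$.
   Context: For $n\in\mathbb{N}$, $D(n)$ is the set of positive divisors of $n$. For $A\subset\mathbb{N}$, $S_A=\sum_{a\in A}a$ ($S_\emptyset=0$, $S_A=+\infty$ for infinite $A$), and $A$ is a practical set if every non-negative integer $k\le S_A$ is a sum of distinct elements of $A$. A number $n\in\mathbb{N}$ is $A$-practical if $D(n)\cap A$ is a practical set, and $\Pr(A)$ is the set of all $A$-practical numbers. The partial order $\prec$ on $\mathcal{P}(\mathbb{N})$ is defined by $A\prec A'$ iff $A\subseteq A'$ and $\Pr(A)\subseteq\Pr(A')$. $A$ is minimal if there is no $B\ne A$ with $B\prec A$, and maximal if there is no $B\neq A$ with $A\prec B$. *)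

theory Defs
  imports Main "HOL-Library.Extended_Nat"
begin

(* The natural numbers start at 1; they are embedded in nat as the positive elements. *)
definition pnat :: "nat set" where
  "pnat = {n. 0 < n}"

definition pos_divisors :: "nat \<Rightarrow> nat set" where
  "pos_divisors n = {d. 0 < d \<and> d dvd n}"

definition elem_sum :: "nat set \<Rightarrow> enat" where
  "elem_sum A = (if finite A then enat (\<Sum>A) else \<infinity>)"

definition practical_set :: "nat set \<Rightarrow> bool" where
  "practical_set A \<longleftrightarrow>
     (\<forall>k::nat. enat k \<le> elem_sum A \<longrightarrow> (\<exists>B. B \<subseteq> A \<and> finite B \<and> \<Sum>B = k))"

definition practical_numbers :: "nat set \<Rightarrow> nat set" where
  "practical_numbers A = {n \<in> pnat. practical_set (pos_divisors n \<inter> A)}"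

(* The non-strict order, meant for subsets of pnat; it is reflexive. *)
definition prec :: "nat set \<Rightarrow> nat set \<Rightarrow> bool"  (infix "\<prec>" 50) where
  "A \<prec> A' \<longleftrightarrow> A \<subseteq> A' \<and> practical_numbers A \<subseteq> practical_numbers A'"

definition minimal_elem :: "nat set \<Rightarrow> bool" where
  "minimal_elem A \<longleftrightarrow> A \<in> Pow pnat \<and> \<not> (\<exists>B \<in> Pow pnat. B \<noteq> A \<and> B \<prec> A)"

definition maximal_elem :: "nat set \<Rightarrow> bool" where
  "maximal_elem A \<longleftrightarrow> A \<in> Pow pnat \<and> \<not> (\<exists>B \<in> Pow pnat. B \<noteq> A \<and> A \<prec> B)"

end

theory Submission
  imports Defs
begin

text \<open>Membership of \<open>n\<close> in the practical numbers of \<open>A\<close> depends only on the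
  trace of \<open>A\<close> on the finite set of divisors of \<open>n\<close>. On a finite set the union and the
  intersection of a chain agree with some member of the chain, so both are bounds of the chain with
  respect to \<open>\<prec>\<close>, and Zorn's lemma applies in both directions.\<close>

lemma finite_pos_divisors: "0 < n \<Longrightarrow> finite (pos_divisors n)"
  unfolding pos_divisors_def by simp

lemma practical_numbers_cong:
  assumes "pos_divisors n \<inter> A = pos_divisors n \<inter> B"
  shows "n \<in> practical_numbers A \<longleftrightarrow> n \<in> practical_numbers B"
  using assms unfolding practical_numbers_def by simp

lemma prec_refl: "A \<prec> A"
  unfolding prec_def by simp

lemma prec_trans: "A \<prec> B \<Longrightarrow> B \<prec> C \<Longrightarrow> A \<prec> C"
  unfolding prec_def by blast

lemma prec_Union_chain:
  assumes chain: "\<And>X Y. X \<in> C \<Longrightarrow> Y \<in> C \<Longrightarrow> X \<prec> Y \<or> Y \<prec> X" and "A \<in> C"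
  shows "A \<prec> \<Union>C"
  unfolding prec_def
proof (intro conjI subsetI)
  fix n assume n: "n \<in> practical_numbers A"
  \<comment> \<open>Practical numbers lie in \<open>pnat\<close>, which excludes
    \<open>n = 0\<close>, whose set of divisors is infinite.\<close>
  then have fin: "finite (pos_divisors n \<inter> \<Union>C)"
    by (simp add: practical_numbers_def pnat_def finite_pos_divisors)
  have "subset.chain UNIV C"
    unfolding subset_chain_def using chain by (simp add: prec_def) blast
  moreover have "C \<noteq> {}"
    using \<open>A \<in> C\<close> by blast
  ultimately obtain B where B: "B \<in> C" "pos_divisors n \<inter> \<Union>C \<subseteq> B"
    using finite_subset_Union_chain[OF fin Int_lower2] by metis
  \<comment> \<open>The member \<open>B\<close> has the same trace on the divisors of
    \<open>n\<close> as the union. If it lies above \<open>A\<close>, then \<open>n\<close> passes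
    from \<open>A\<close> to \<open>B\<close> by \<open>\<prec>\<close>. Otherwise \<open>A\<close>
    is squeezed between \<open>B\<close> and the union, so \<open>A\<close> has that trace
    too.\<close>
  consider "A \<prec> B" | "B \<subseteq> A"
    using chain[OF \<open>A \<in> C\<close> B(1)] unfolding prec_def by blast
  then show "n \<in> practical_numbers (\<Union>C)"
  proof cases
    case 1
    then have "n \<in> practical_numbers B"
      using n unfolding prec_def by blast
    moreover have "pos_divisors n \<inter> B = pos_divisors n \<inter> \<Union>C"
      using B by blast
    ultimately show ?thesis
      using practical_numbers_cong by metis
  next
    case 2
    then have "pos_divisors n \<inter> A = pos_divisors n \<inter> \<Union>C"
      using B \<open>A \<in> C\<close> by blast
    then show ?thesis
      using n practical_numbers_cong by metis
  qed
qed (use \<open>A \<in> C\<close> in blast)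

lemma Inter_chain_prec:
  assumes chain: "\<And>X Y. X \<in> C \<Longrightarrow> Y \<in> C \<Longrightarrow> X \<prec> Y \<or> Y \<prec> X" and "A \<in> C"
  shows "\<Inter>C \<prec> A"
  unfolding prec_def
proof (intro conjI subsetI)
  fix n assume n: "n \<in> practical_numbers (\<Inter>C)"
  then have fin: "finite (pos_divisors n - \<Inter>C)"
    by (simp add: practical_numbers_def pnat_def finite_pos_divisors)
  have "X \<subseteq> Y \<or> Y \<subseteq> X" if "X \<in> C" "Y \<in> C" for X Y
    using chain[OF that] unfolding prec_def by blast
  \<comment> \<open>Complements form a chain whose union is the complement of
    \<open>\<Inter>C\<close>. A single \<open>- B\<close> therefore covers the finitely many
    divisors of \<open>n\<close> outside \<open>\<Inter>C\<close>, so \<open>B\<close> has the same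
    trace as the intersection.\<close>
  then have "subset.chain UNIV (uminus ` C)"
    unfolding subset_chain_def by auto
  moreover have "uminus ` C \<noteq> {}"
    using \<open>A \<in> C\<close> by blast
  moreover have "pos_divisors n - \<Inter>C \<subseteq> \<Union>(uminus ` C)"
    by blast
  ultimately obtain B where B: "B \<in> C" "pos_divisors n - \<Inter>C \<subseteq> - B"
    using finite_subset_Union_chain[OF fin] by (metis imageE)
  consider "B \<prec> A" | "A \<subseteq> B"
    using chain[OF \<open>A \<in> C\<close> B(1)] unfolding prec_def by blast
  then show "n \<in> practical_numbers A"
  proof cases
    case 1
    have "pos_divisors n \<inter> B = pos_divisors n \<inter> \<Inter>C"
      using B by blast
    then have "n \<in> practical_numbers B"
      using n practical_numbers_cong by metis
    then show ?thesis
      using 1 unfolding prec_def by blast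
  next
    case 2
    then have "pos_divisors n \<inter> A = pos_divisors n \<inter> \<Inter>C"
      using B \<open>A \<in> C\<close> by blast
    then show ?thesis
      using n practical_numbers_cong by metis
  qed
qed (use \<open>A \<in> C\<close> in blast)

lemma ex_maximal_above:
  assumes "A \<subseteq> pnat"
  shows "\<exists>M. A \<prec> M \<and> maximal_elem M"
proof -
  \<comment> \<open>The bound \<open>X \<subseteq> pnat\<close> is imposed because supersets of
    \<open>A\<close> could contain 0, whereas maximality is meant within
    \<open>Pow pnat\<close>.\<close>
  let ?S = "{X. X \<subseteq> pnat \<and> A \<prec> X}"
  have "\<exists>M\<in>?S. \<forall>X\<in>?S. M \<prec> X \<longrightarrow> X = M"
  proof (rule predicate_Zorn)
    show "partial_order_on ?S (relation_of (\<prec>) ?S)"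
      by (rule partial_order_on_relation_ofI) (auto simp: prec_def)
  next
    fix C assume C: "C \<in> Chains (relation_of (\<prec>) ?S)"
    show "\<exists>U\<in>?S. \<forall>X\<in>C. X \<prec> U"
    \<comment> \<open>The empty chain is bounded by \<open>A\<close> itself, since its union
      \<open>{}\<close> need not lie above \<open>A\<close>.\<close>
    proof (cases "C = {}")
      case True
      then show ?thesis
        using assms prec_refl by blast
    next
      case False
      have CS: "C \<subseteq> ?S"
        using C by (rule Chains_relation_of)
      have bound: "X \<prec> \<Union>C" if "X \<in> C" for X
        using C that by (intro prec_Union_chain) (auto simp: Chains_def relation_of_def)
      then have "A \<prec> \<Union>C"
        using False CS prec_trans by blast
      then show ?thesis
        using bound CS by blast
    qed
  qed
  then obtain M where "M \<in> ?S" and "\<forall>X\<in>?S. M \<prec> X \<longrightarrow> X = M" ..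
  then have M: "M \<subseteq> pnat" "A \<prec> M"
    and max: "\<And>X. X \<subseteq> pnat \<Longrightarrow> A \<prec> X \<Longrightarrow> M \<prec> X \<Longrightarrow> X = M"
    by simp_all
  \<comment> \<open>Anything above \<open>M\<close> is above \<open>A\<close> by transitivity, so
    maximality in \<open>?S\<close> extends to all of \<open>Pow pnat\<close>.\<close>
  have "X = M" if "X \<subseteq> pnat" "M \<prec> X" for X
    using max[OF that(1) prec_trans[OF M(2) that(2)] that(2)] .
  with M show ?thesis
    unfolding maximal_elem_def by blast
qed

lemma ex_minimal_below:
  assumes "A \<subseteq> pnat"
  shows "\<exists>M. M \<prec> A \<and> minimal_elem M"
proof -
  \<comment> \<open>Here membership in \<open>Pow pnat\<close> is inherited from \<open>A\<close>,
    as \<open>X \<prec> A\<close> includes \<open>X \<subseteq> A\<close>.\<close>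
  let ?S = "{X. X \<prec> A}"
  have "\<exists>M\<in>?S. \<forall>X\<in>?S. X \<prec> M \<longrightarrow> X = M"
  \<comment> \<open>Zorn's lemma is applied to the reversed order, so upper bounds become lower
    bounds and the maximal element found is minimal for \<open>\<prec>\<close>.\<close>
  proof (rule predicate_Zorn[where P = "\<lambda>X Y. Y \<prec> X"])
    show "partial_order_on ?S (relation_of (\<lambda>X Y. Y \<prec> X) ?S)"
      by (rule partial_order_on_relation_ofI) (auto simp: prec_def)
  next
    fix C assume C: "C \<in> Chains (relation_of (\<lambda>X Y. Y \<prec> X) ?S)"
    show "\<exists>L\<in>?S. \<forall>X\<in>C. L \<prec> X"
    proof (cases "C = {}")
      case True
      then show ?thesis
        using prec_refl by blast
    next
      case False
      have CS: "C \<subseteq> ?S"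
        using C by (rule Chains_relation_of)
      have bound: "\<Inter>C \<prec> X" if "X \<in> C" for X
        using C that by (intro Inter_chain_prec) (auto simp: Chains_def relation_of_def)
      then have "\<Inter>C \<prec> A"
        using False CS prec_trans by blast
      then show ?thesis
        using bound by blast
    qed
  qed
  then obtain M where M: "M \<prec> A" and min: "\<And>X. X \<prec> A \<Longrightarrow> X \<prec> M \<Longrightarrow> X = M"
    by blast
  have "X = M" if "X \<prec> M" for X
    using min[OF prec_trans[OF that M] that] .
  moreover have "M \<subseteq> pnat"
    using M assms unfolding prec_def by blast
  ultimately show ?thesis
    using M unfolding minimal_elem_def by blast
qed

theorem theorem3p11:
  fixes A :: "nat set"
  assumes "A \<subseteq> pnat"
  shows "\<exists>A' A''. A' \<subseteq> A \<and> A \<subseteq> A'' \<and> A'' \<subseteq> pnat \<and>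
           A' \<prec> A \<and> A \<prec> A'' \<and> minimal_elem A' \<and> maximal_elem A''"
proof -
  obtain A' where "A' \<prec> A" "minimal_elem A'"
    using ex_minimal_below assms by blast
  moreover obtain A'' where "A \<prec> A''" "maximal_elem A''"
    using ex_maximal_above assms by blast
  moreover have "A' \<subseteq> A" "A \<subseteq> A''" "A'' \<subseteq> pnat"
    using calculation unfolding prec_def maximal_elem_def by blast+
  ultimately show ?thesis
    by blast
qed

end
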